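(* Let $G$ be a connected graph and $X\subseteq V(G)$. Then $X$ is a total general position set of $G$ if and only if $X\subseteq S(G)$, where $S(G)$ is the set of simplicial vertices of $G$. Moreover, $\mathrm{gp}_{\mathrm t}(G)=s(G)$, where $s(G)=|S(G)|$.
   Context: All graphs are finite, simple, nonempty and connected. A vertex of $G$ is simplicial if its open neighbourhood induces a complete subgraph (the empty graph counts as complete). For $X\subseteq V(G)$, vertices $u,v\in V(G)$ are $X$-positionable if for every shortest $u,v$-path $P$ in $G$ we have $V(P)\cap X\subseteq\{u,v\}$. A set $X\subseteq V(G)$ is a total general position set if every two vertices $u,v\in V(G)$ are $X$-positionable. The total general position number $\mathrm{gp}_{\mathrm t}(G)$ is the cardinality of a largest total general position set of $G$ (it is $0$ if only the empty set has the property). *)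

theory Defs
  imports "Graph_Theory.Graph_Theory"
begin

text \<open>
  A finite simple graph is the library's \<open>graph G\<close>: a finite, loop-free, symmetric
  digraph without parallel arcs, every undirected edge being a pair of opposite arcs.
  The library's \<open>connected G\<close> includes nonemptiness of the vertex set.
\<close>

definition open_nbhd :: "('a, 'b) pre_digraph \<Rightarrow> 'a \<Rightarrow> 'a set" where
  "open_nbhd G v = {w. v \<rightarrow>\<^bsub>G\<^esub> w}"

text \<open>The empty graph counts as complete (it is \<open>K\<^bsub>0\<^esub>\<close>).\<close>

definition complete_graph :: "('a, 'b) pre_digraph \<Rightarrow> bool" where
  "complete_graph H \<longleftrightarrow> complete_digraph (card (verts H)) H"

definition simplicial :: "('a, 'b) pre_digraph \<Rightarrow> 'a \<Rightarrow> bool" where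
  "simplicial G v \<longleftrightarrow> v \<in> verts G \<and> complete_graph (G \<restriction> open_nbhd G v)"

definition simplicial_verts :: "('a, 'b) pre_digraph \<Rightarrow> 'a set" where
  "simplicial_verts G = {v. simplicial G v}"

definition simplicial_number :: "('a, 'b) pre_digraph \<Rightarrow> nat" where
  "simplicial_number G = card (simplicial_verts G)"

text \<open>
  Since there are no parallel arcs, a path is determined by its list of vertices, so
  \<open>V(P)\<close> is \<open>set P\<close>. For \<open>u = v\<close> the only path is \<open>[u]\<close>, of length 0.
\<close>

definition path_between :: "('a, 'b) pre_digraph \<Rightarrow> 'a \<Rightarrow> 'a vwalk \<Rightarrow> 'a \<Rightarrow> bool" where
  "path_between G u P v \<longleftrightarrow> vpath P G \<and> hd P = u \<and> last P = v"

definition shortest_path :: "('a, 'b) pre_digraph \<Rightarrow> 'a \<Rightarrow> 'a vwalk \<Rightarrow> 'a \<Rightarrow> bool" where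
  "shortest_path G u P v \<longleftrightarrow> path_between G u P v \<and>
     (\<forall>Q. path_between G u Q v \<longrightarrow> vwalk_length P \<le> vwalk_length Q)"

definition positionable :: "('a, 'b) pre_digraph \<Rightarrow> 'a set \<Rightarrow> 'a \<Rightarrow> 'a \<Rightarrow> bool" where
  "positionable G X u v \<longleftrightarrow> (\<forall>P. shortest_path G u P v \<longrightarrow> set P \<inter> X \<subseteq> {u, v})"

definition total_gp_set :: "('a, 'b) pre_digraph \<Rightarrow> 'a set \<Rightarrow> bool" where
  "total_gp_set G X \<longleftrightarrow> X \<subseteq> verts G \<and> (\<forall>u \<in> verts G. \<forall>v \<in> verts G. positionable G X u v)"

text \<open>
  For finite \<open>G\<close> the maximum is over a finite set, which contains 0 because the empty
  set is a total general position set.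
\<close>

definition total_gp_number :: "('a, 'b) pre_digraph \<Rightarrow> nat" where
  "total_gp_number G = Max {card X |X. total_gp_set G X}"

end

(* If x is not simplicial, two non-adjacent neighbours a, b of x give the shortest path
   a, x, b through x, so x lies in no total general position set. Conversely, a shortest path
   with a simplicial inner vertex x could be shortened by deleting x, because the two
   neighbours of x on the path are adjacent. *)
theory Submission
  imports Defs
begin

lemma graph_arcs_ends_sym:
  assumes "graph G" "u \<rightarrow>\<^bsub>G\<^esub> v"
  shows "v \<rightarrow>\<^bsub>G\<^esub> u"
proof -
  interpret graph G by fact
  show ?thesis using arcs_ends_symmetric[OF sym_arcs assms(2)] .
qed

lemma graph_arcs_ends_irrefl:
  assumes "graph G" "u \<rightarrow>\<^bsub>G\<^esub> v"
  shows "u \<noteq> v"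
proof -
  interpret graph G by fact
  show ?thesis using assms(2) adj_not_same by blast
qed

lemma graph_arcs_ends_verts:
  assumes "graph G" "u \<rightarrow>\<^bsub>G\<^esub> v"
  shows "u \<in> verts G" "v \<in> verts G"
proof -
  interpret graph G by fact
  show "u \<in> verts G" "v \<in> verts G" using assms(2) by (auto elim!: reachableE)
qed

lemma arcs_ends_induce_subgraph:
  "arcs_ends (G \<restriction> S) = {(u, v). u \<rightarrow>\<^bsub>G\<^esub> v \<and> u \<in> S \<and> v \<in> S}"
  by (auto simp: arcs_ends_conv)

text \<open>Turns completeness of the induced neighbourhood into plain adjacency in
  \<open>G\<close>. The order required by \<open>complete_digraph\<close> is right by definition of
  \<open>complete_graph\<close>, and arcs always have distinct ends, so only the adjacency of
  distinct neighbours remains.\<close>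

lemma simplicial_iff:
  assumes "graph G"
  shows "simplicial G x \<longleftrightarrow>
    x \<in> verts G \<and> (\<forall>a b. x \<rightarrow>\<^bsub>G\<^esub> a \<longrightarrow> x \<rightarrow>\<^bsub>G\<^esub> b \<longrightarrow> a \<noteq> b \<longrightarrow> a \<rightarrow>\<^bsub>G\<^esub> b)"
proof -
  interpret graph G by fact
  let ?H = "G \<restriction> open_nbhd G x"
  have ind: "induced_subgraph ?H G"
    using graph_arcs_ends_verts(2)[OF assms] by (intro induced_induce) (auto simp: open_nbhd_def)
  \<comment> \<open>\<open>complete_digraph\<close> also requires its argument to be a
    \<open>graph\<close>; the induced subgraph inherits this from \<open>G\<close>.\<close>
  have "graph ?H"
    using digraphI_induced[OF ind] induced_graph_imp_symmetric[OF sym_arcs ind]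
    by (rule digraph.graphI)
  then show ?thesis
    using graph_arcs_ends_irrefl[OF assms]
    by (auto simp: simplicial_def complete_graph_def complete_digraph_def
        arcs_ends_induce_subgraph open_nbhd_def set_eq_iff)
qed

text \<open>The arc from \<open>last p\<close> to \<open>hd q\<close> replaces the two arcs at
  \<open>x\<close>; the other arcs and the distinctness of the vertices are inherited.\<close>

lemma vpath_delete_inner:
  assumes "vpath (p @ x # q) G" "p \<noteq> []" "q \<noteq> []" "last p \<rightarrow>\<^bsub>G\<^esub> hd q"
  shows "vpath (p @ q) G"
  using assms by (auto simp: vpath_def vwalk_def vwalk_arcs_append)

lemma total_gp_set_imp_simplicial:
  assumes G: "graph G" and X: "total_gp_set G X" and x: "x \<in> X"
  shows "simplicial G x"
proof -
  have "a \<rightarrow>\<^bsub>G\<^esub> b" if xa: "x \<rightarrow>\<^bsub>G\<^esub> a" and xb: "x \<rightarrow>\<^bsub>G\<^esub> b" and ab: "a \<noteq> b" for a b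
  proof (rule ccontr)
    assume nab: "\<not> a \<rightarrow>\<^bsub>G\<^esub> b"
    note V = graph_arcs_ends_verts[OF G xa] graph_arcs_ends_verts[OF G xb]
    have ne: "x \<noteq> a" "x \<noteq> b"
      using xa xb graph_arcs_ends_irrefl[OF G] by blast+
    have path: "path_between G a [a, x, b] b"
      using graph_arcs_ends_sym[OF G xa] xb V ab ne
      by (auto simp: path_between_def vpath_def vwalk_def)
    have "vwalk_length [a, x, b] \<le> vwalk_length Q" if Q: "path_between G a Q b" for Q
    \<comment> \<open>The split follows the recursion of \<open>vwalk_arcs\<close>: no vertex, which
      is not a walk; one vertex, which would force \<open>a = b\<close>; at least two
      vertices.\<close>
    proof (cases Q rule: vwalk_arcs.cases)
      case 1
      then show ?thesis using Q by (auto simp: path_between_def vpath_def vwalk_def)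
    next
      case (2 y)
      then show ?thesis using Q ab by (auto simp: path_between_def)
    next
      \<comment> \<open>If \<open>zs\<close> is empty, then \<open>Q\<close> is
        \<open>[a, b]\<close>, whose arc \<open>nab\<close> excludes; otherwise \<open>Q\<close> has
        at least two arcs.\<close>
      case (3 y z zs)
      then show ?thesis
        using Q nab by (cases zs) (auto simp: path_between_def vpath_def vwalk_def)
    qed
    then have "shortest_path G a [a, x, b] b"
      using path unfolding shortest_path_def by blast
    then have "set [a, x, b] \<inter> X \<subseteq> {a, b}"
      using X V unfolding total_gp_set_def positionable_def by blast
    then show False using x ne by auto
  qed
  then show ?thesis
    using X x by (auto simp: simplicial_iff[OF G] total_gp_set_def)
qed

lemma simplicial_in_shortest_path:
  assumes G: "graph G" and P: "shortest_path G u P v" and x: "x \<in> set P" "simplicial G x"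
  shows "x \<in> {u, v}"
proof (rule ccontr)
  assume "x \<notin> {u, v}"
  obtain p q where pq: "P = p @ x # q"
    using x(1) by (auto dest: split_list)
  have path: "vpath P G" "hd P = u" "last P = v"
    using P by (auto simp: shortest_path_def path_between_def)
  \<comment> \<open>As \<open>x\<close> is neither end of \<open>P\<close>, it has a predecessor
    \<open>last p\<close> and a successor \<open>hd q\<close> there.\<close>
  have ne: "p \<noteq> []" "q \<noteq> []"
    using pq path \<open>x \<notin> {u, v}\<close> by auto
  have "last p \<rightarrow>\<^bsub>G\<^esub> x" and xq: "x \<rightarrow>\<^bsub>G\<^esub> hd q"
    using path(1) ne by (auto simp: pq vpath_def vwalk_def vwalk_arcs_append)
  then have "x \<rightarrow>\<^bsub>G\<^esub> last p"
    using graph_arcs_ends_sym[OF G] by blast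
  \<comment> \<open>Simpliciality joins only distinct neighbours; these two differ because a path
    repeats no vertex.\<close>
  moreover have "last p \<noteq> hd q"
  proof -
    have "set p \<inter> set q = {}" using path(1) by (auto simp: pq vpath_def)
    then show ?thesis using ne last_in_set hd_in_set by fastforce
  qed
  ultimately have "last p \<rightarrow>\<^bsub>G\<^esub> hd q"
    using x(2) xq unfolding simplicial_iff[OF G] by blast
  then have "vpath (p @ q) G"
    using vpath_delete_inner path(1) ne unfolding pq by metis
  then have "path_between G u (p @ q) v"
    using path(2,3) ne by (auto simp: pq path_between_def)
  then have "vwalk_length P \<le> vwalk_length (p @ q)"
    using P by (auto simp: shortest_path_def)
  \<comment> \<open>Both vertex lists are nonempty, so each length is one less than the number of
    vertices, and deleting \<open>x\<close> lowers it by one.\<close>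
  then show False using ne by (cases p) (auto simp: pq)
qed

lemma total_gp_set_iff:
  assumes G: "graph G"
  shows "total_gp_set G X \<longleftrightarrow> X \<subseteq> simplicial_verts G"
proof
  assume "total_gp_set G X"
  then show "X \<subseteq> simplicial_verts G"
    using total_gp_set_imp_simplicial[OF G] by (auto simp: simplicial_verts_def)
next
  assume X: "X \<subseteq> simplicial_verts G"
  have "positionable G X u v" for u v
    using X simplicial_in_shortest_path[OF G]
    unfolding positionable_def simplicial_verts_def by blast
  moreover have "X \<subseteq> verts G"
    using X by (auto simp: simplicial_verts_def simplicial_def)
  ultimately show "total_gp_set G X"
    by (simp add: total_gp_set_def)
qed

text \<open>By \<open>total_gp_set_iff\<close> the competing sets are exactly the subsets of the
  finite set \<open>simplicial_verts G\<close>, which is itself the largest of them.\<close>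

lemma total_gp_number_eq:
  assumes G: "graph G"
  shows "total_gp_number G = simplicial_number G"
proof -
  interpret graph G by fact
  have "simplicial_verts G \<subseteq> verts G"
    by (auto simp: simplicial_verts_def simplicial_def)
  then have fin: "finite (simplicial_verts G)"
    using finite_verts by (rule finite_subset)
  have "{card X |X. total_gp_set G X} = card ` Pow (simplicial_verts G)"
    by (auto simp: total_gp_set_iff[OF G])
  moreover have "Max (card ` Pow (simplicial_verts G)) = card (simplicial_verts G)"
    using fin by (intro Max_eqI) (auto intro: card_mono)
  ultimately show ?thesis
    by (simp add: total_gp_number_def simplicial_number_def)
qed

theorem theorem2p1:
  fixes G :: "('a, 'b) pre_digraph"
  assumes "graph G"
    and "Digraph_Component.connected G"
  shows "(\<forall>X. X \<subseteq> verts G \<longrightarrow> (total_gp_set G X \<longleftrightarrow> X \<subseteq> simplicial_verts G))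
    \<and> total_gp_number G = simplicial_number G"
  using total_gp_set_iff[OF assms(1)] total_gp_number_eq[OF assms(1)] by blast

end
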